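(* Let $w_1,w_2,w_3$ be any odd positive integers and let $n\ge 0$ be an integer. Then \begin{align*} &\sum_{k+l+m=n}\binom{n}{k,l,m}T_k(w_1d-1;\chi,\xi^{w_3})T_l(w_2d-1;\chi,\xi^{w_1})T_m(w_3d-1;\chi,\xi^{w_2})\,w_{3}^{k}w_{1}^{l}w_{2}^{m}\\ =&\sum_{k+l+m=n}\binom{n}{k,l,m}T_k(w_1d-1;\chi,\xi^{w_2})T_l(w_3d-1;\chi,\xi^{w_1})T_m(w_2d-1;\chi,\xi^{w_3})\,w_{2}^{k}w_{1}^{l}w_{3}^{m}. \end{align*}
   Context: Let $p$ be a fixed odd prime and $\mathbb{C}_p$ the completion of an algebraic closure of $\mathbb{Q}_p$. Let $\xi\in\mathbb{C}_p$ be a fixed ramified root of unity, i.e. $\xi^{p^s}=1$ for some positive integer $s$. Let $d$ be a fixed odd positive integer and $\chi$ a primitive Dirichlet character of conductor $d$, regarded as a function on the integers (periodic mod $d$, zero on integers not coprime to $d$) with values in $\mathbb{C}_p$ via a fixed embedding $\overline{\mathbb{Q}}\to\mathbb{C}_p$. For a root of unity $\zeta$ (e.g. $\zeta=\xi^w$), the alternating generalized twisted power sum is $T_k(N;\chi,\zeta)=\sum_{a=0}^{N}(-1)^a\chi(a)\zeta^a a^k$ (with $0^0=1$). The sums are over nonnegative integers $k,l,m$ with $k+l+m=n$, and $\binom{n}{k,l,m}=\frac{n!}{k!\,l!\,m!}$. *)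

theory Defs
  imports "HOL-Analysis.Elementary_Topology" "HOL-Computational_Algebra.Computational_Algebra"
    "HOL-Number_Theory.Cong"
begin

definition padic_abs :: "nat \<Rightarrow> rat \<Rightarrow> real" where
  "padic_abs p q =
     (if q = 0 then 0
      else case quotient_of q of (a, b) \<Rightarrow>
        real p powi (int (multiplicity (int p) b) - int (multiplicity (int p) a)))"

definition algebraic_elements_over :: "'a::field set \<Rightarrow> 'a set" where
  "algebraic_elements_over F =
     {x. \<exists>P. P \<noteq> 0 \<and> (\<forall>i. coeff P i \<in> F) \<and> poly P x = 0}"

text \<open>
  A type satisfies the following predicate iff it is a completion of an algebraic closure of
  the field of p-adic numbers; this determines it up to isometric isomorphism. The absolute
  value of \<open>x\<close> is \<open>dist x 0\<close>, and metric completeness is part of the class \<open>complete_space\<close>.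
  Since the absolute value extends the p-adic one, \<open>closure \<rat>\<close> is the completion of the
  rationals for the latter, i.e. the p-adic field. The fourth conjunct says that the elements
  algebraic over it form an algebraically closed field, i.e. an algebraic closure of it.
  The ultrametric inequality need not be required, as it holds for every absolute value that
  is bounded on the integers.
\<close>

definition completed_algebraic_closure_of_Qp ::
    "nat \<Rightarrow> 'a::{field_char_0, complete_space} itself \<Rightarrow> bool" where
  "completed_algebraic_closure_of_Qp p K \<longleftrightarrow>
     (let Qp = closure (\<rat> :: 'a set); Qp_bar = algebraic_elements_over Qp in
       (\<forall>x y :: 'a. dist x y = dist (x - y) 0) \<and>
       (\<forall>x y :: 'a. dist (x * y) 0 = dist x 0 * dist y 0) \<and>
       (\<forall>q. dist (of_rat q :: 'a) 0 = padic_abs p q) \<and>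
       (\<forall>P. degree P > 0 \<and> (\<forall>i. coeff P i \<in> Qp_bar) \<longrightarrow> (\<exists>x \<in> Qp_bar. poly P x = 0)) \<and>
       closure Qp_bar = UNIV)"

text \<open>The algebraic closure of the rationals is taken to be the field of complex algebraic numbers.\<close>

definition embedding_of_Qbar :: "(complex \<Rightarrow> 'a::field_char_0) \<Rightarrow> bool" where
  "embedding_of_Qbar \<iota> \<longleftrightarrow>
     \<iota> 1 = 1 \<and>
     (\<forall>x y. algebraic x \<and> algebraic y \<longrightarrow> \<iota> (x + y) = \<iota> x + \<iota> y \<and> \<iota> (x * y) = \<iota> x * \<iota> y) \<and>
     inj_on \<iota> {x. algebraic x}"

definition dirichlet_character :: "nat \<Rightarrow> (int \<Rightarrow> complex) \<Rightarrow> bool" where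
  "dirichlet_character d chi \<longleftrightarrow>
     d > 0 \<and>
     (\<forall>a. chi (a + int d) = chi a) \<and>
     (\<forall>a b. chi (a * b) = chi a * chi b) \<and>
     (\<forall>a. chi a \<noteq> 0 \<longleftrightarrow> coprime a (int d))"

text \<open>
  The least divisor \<open>e\<close> of \<open>d\<close> such that \<open>chi\<close>, as a character of the units modulo \<open>d\<close>, factors
  through the units modulo \<open>e\<close>.
\<close>

definition conductor :: "nat \<Rightarrow> (int \<Rightarrow> complex) \<Rightarrow> nat" where
  "conductor d chi =
     (LEAST e. e > 0 \<and> e dvd d \<and>
        (\<forall>a. coprime a (int d) \<and> [a = 1] (mod int e) \<longrightarrow> chi a = 1))"

definition primitive_dirichlet_character :: "nat \<Rightarrow> (int \<Rightarrow> complex) \<Rightarrow> bool" where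
  "primitive_dirichlet_character d chi \<longleftrightarrow> dirichlet_character d chi \<and> conductor d chi = d"

definition alt_power_sum :: "nat \<Rightarrow> nat \<Rightarrow> (int \<Rightarrow> 'a::field_char_0) \<Rightarrow> 'a \<Rightarrow> 'a" where
  "alt_power_sum k N chi \<zeta> =
     (\<Sum>a = 0..N. (- 1) ^ a * chi (int a) * \<zeta> ^ a * of_nat a ^ k)"

definition trinomial :: "nat \<Rightarrow> nat \<Rightarrow> nat \<Rightarrow> nat \<Rightarrow> 'a::field_char_0" where
  "trinomial n k l m = fact n / (fact k * fact l * fact m)"

end

theory Submission
  imports Defs
begin

text \<open>
  Put \<open>u = \<xi> e\<^sup>t\<close>, a formal power series. The numbers \<open>w\<^sup>k T\<^sub>k(vd - 1; \<chi>, \<xi>\<^sup>w)\<close> have exponential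
  generating function \<open>F(v, u\<^sup>w)\<close> with \<open>F(v, x) = \<Sum>a<vd. (-1)\<^sup>a \<chi>(a) x\<^sup>a\<close>. As \<open>\<chi>\<close> is periodic
  modulo \<open>d\<close>, and \<open>d\<close> and \<open>v\<close> are odd, \<open>(1 + x\<^sup>d) F(v, x) = F(1, x) (1 + x\<^bsup>vd\<^esup>)\<close>. With
  \<open>E(w) = 1 + u\<^bsup>wd\<^esup>\<close>, both sides of the theorem are therefore \<open>n!\<close> times the \<open>n\<close>-th coefficient of
  \<open>F(1, u\<^bsup>w1\<^esup>) F(1, u\<^bsup>w2\<^esup>) F(1, u\<^bsup>w3\<^esup>) E(w1 w2) E(w2 w3) E(w1 w3) / (E(w1) E(w2) E(w3))\<close>.
\<close>

lemma fps_mult3_nth: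
  fixes A B C :: "'a::comm_semiring_1 fps"
  shows "(A * B * C) $ n =
    (\<Sum>(k, l, m) \<in> {(k, l, m). k + l + m = n}. A $ k * B $ l * C $ m)"
proof -
  have "(A * B * C) $ n = (\<Sum>i = 0..n. \<Sum>k = 0..i. A $ k * B $ (i - k) * C $ (n - i))"
    by (simp add: fps_mult_nth sum_distrib_right)
  also have "\<dots> = (\<Sum>(i, k) \<in> (SIGMA i:{0..n}. {0..i}). A $ k * B $ (i - k) * C $ (n - i))"
    by (rule sum.Sigma) auto
  \<comment> \<open>In the double sum \<open>i\<close> plays the role of \<open>k + l\<close>, hence
    \<open>i - k\<close> is \<open>l\<close> and \<open>n - i\<close> is \<open>m\<close>.\<close>
  also have "\<dots> = (\<Sum>(k, l, m) \<in> {(k, l, m). k + l + m = n}. A $ k * B $ l * C $ m)"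
    by (rule sum.reindex_bij_witness
          [where i = "\<lambda>(k, l, m). (k + l, k)" and j = "\<lambda>(i, k). (k, i - k, n - i)"]) auto
  finally show ?thesis .
qed

lemma trinomial_sum_eq_fps_nth:
  fixes a b c :: "nat \<Rightarrow> 'a::field_char_0"
  shows "(\<Sum>(k, l, m) \<in> {(k, l, m). k + l + m = n}. trinomial n k l m * (a k * b l * c m)) =
    fact n * (Abs_fps (\<lambda>k. a k / fact k) * Abs_fps (\<lambda>k. b k / fact k)
              * Abs_fps (\<lambda>k. c k / fact k)) $ n"
  unfolding fps_mult3_nth sum_distrib_left
  by (rule sum.cong) (auto simp: trinomial_def)

text \<open>Works over any commutative ring, so that \<open>x\<close> can be a power series. The
  strict bound \<open>a < N\<close> makes the range \<open>v * d\<close> split into full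
  periods.\<close>

definition alt_twisted_sum :: "(int \<Rightarrow> 'a::comm_ring_1) \<Rightarrow> nat \<Rightarrow> 'a \<Rightarrow> 'a" where
  "alt_twisted_sum f N x = (\<Sum>a<N. (- 1) ^ a * f (int a) * x ^ a)"

text \<open>The range consists of \<open>v\<close> blocks of length \<open>d\<close>. As
  \<open>d\<close> is odd, block \<open>j\<close> is the first one times
  \<open>(- (x ^ d)) ^ j\<close>, so the blocks form a geometric sum.\<close>

lemma alt_twisted_sum_periodic:
  fixes f :: "int \<Rightarrow> 'a::comm_ring_1"
  assumes per: "\<And>a. f (a + int d) = f a" and "odd d" and "odd v"
  shows "(1 + x ^ d) * alt_twisted_sum f (v * d) x = alt_twisted_sum f d x * (1 + x ^ (v * d))"
proof -
  have per': "f (a + int j * int d) = f a" for a j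
  proof (induction j)
    case (Suc j)
    have "f (a + int (Suc j) * int d) = f (a + int j * int d + int d)"
      by (simp add: algebra_simps)
    then show ?case using per Suc by simp
  qed simp
  have sgn: "(- 1 :: 'a) ^ (d * j) = (- 1) ^ j" for j
    using \<open>odd d\<close> by (cases "even j") auto
  have "alt_twisted_sum f (j * d) x = alt_twisted_sum f d x * (\<Sum>i<j. (- (x ^ d)) ^ i)" for j
  proof (induction j)
    case 0
    then show ?case by (simp add: alt_twisted_sum_def)
  next
    case (Suc j)
    have "alt_twisted_sum f (Suc j * d) x = (\<Sum>a<j * d + d. (- 1) ^ a * f (int a) * x ^ a)"
      by (simp add: alt_twisted_sum_def add.commute)
    also have "\<dots> = alt_twisted_sum f (j * d) x
        + (\<Sum>a<d. (- 1) ^ (j * d + a) * f (int (j * d + a)) * x ^ (j * d + a))"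
      unfolding alt_twisted_sum_def lessThan_atLeast0
      by (subst sum.atLeastLessThan_concat [of 0 "j * d" "j * d + d", symmetric])
         (simp_all add: sum.shift_bounds_nat_ivl [of _ 0 "j * d" d, simplified] add.commute)
    also have "(\<Sum>a<d. (- 1) ^ (j * d + a) * f (int (j * d + a)) * x ^ (j * d + a)) =
        alt_twisted_sum f d x * (- (x ^ d)) ^ j"
      unfolding alt_twisted_sum_def sum_distrib_right
    proof (rule sum.cong [OF refl])
      fix a
      have "f (int (j * d + a)) = f (int a)"
        using per' [of "int a" j] by (simp add: add.commute)
      moreover have "(- (x ^ d)) ^ j = (- 1) ^ j * x ^ (j * d)"
        by (subst power_minus) (simp add: power_mult [symmetric] mult.commute)
      ultimately show "(- 1) ^ (j * d + a) * f (int (j * d + a)) * x ^ (j * d + a) =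
          (- 1) ^ a * f (int a) * x ^ a * (- (x ^ d)) ^ j"
        by (simp add: power_add sgn mult_ac)
    qed
    finally show ?case using Suc by (simp add: algebra_simps)
  qed
  \<comment> \<open>The ratio is \<open>- (x ^ d)\<close>; its \<open>v\<close>-th power is
    \<open>- (x ^ (v * d))\<close> because \<open>v\<close> is odd.\<close>
  moreover have "(1 + x ^ d) * (\<Sum>i<v. (- (x ^ d)) ^ i) = 1 + x ^ (v * d)"
    using one_diff_power_eq [of "- (x ^ d)" v] \<open>odd v\<close>
    by (simp add: power_minus_odd power_mult [symmetric] mult.commute)
  ultimately show ?thesis by (metis mult.left_commute)
qed

lemma fps_const_mult_exp_power:
  fixes c :: "'a::field_char_0"
  shows "(fps_const c * fps_exp 1) ^ m = fps_const (c ^ m) * fps_exp (of_nat m)"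
  by (simp add: power_mult_distrib fps_const_power fps_exp_power_mult)

lemma one_plus_exp_power_nonzero:
  fixes c :: "'a::field_char_0"
  assumes "c \<noteq> 0" and "m > 0"
  shows "1 + (fps_const c * fps_exp 1) ^ m \<noteq> 0"
proof
  assume "1 + (fps_const c * fps_exp 1) ^ m = 0"
  \<comment> \<open>The constant coefficient \<open>1 + c ^ m\<close> may vanish, but the linear one
    is \<open>c ^ m * of_nat m\<close>, nonzero in characteristic 0.\<close>
  then have "(1 + (fps_const c * fps_exp 1) ^ m) $ 1 = 0" by simp
  with assms show False by (simp add: fps_const_mult_exp_power)
qed

text \<open>The weight \<open>of_nat w ^ k\<close> rescales the variable by \<open>w\<close>,
  turning \<open>fps_exp (of_nat a)\<close> into \<open>fps_exp (of_nat (w * a))\<close>. With the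
  twist \<open>(c ^ w) ^ a\<close> this is a power of one series.\<close>

lemma alt_power_sum_egf:
  fixes c :: "'a::field_char_0"
  assumes "N > 0"
  shows "Abs_fps (\<lambda>k. alt_power_sum k (N - 1) f (c ^ w) * of_nat w ^ k / fact k) =
    alt_twisted_sum (\<lambda>a. fps_const (f a)) N ((fps_const c * fps_exp 1) ^ w)"
proof (rule fps_ext)
  fix k
  let ?u = "fps_const c * fps_exp 1 :: 'a fps"
  \<comment> \<open>For \<open>N = 0\<close>, truncated subtraction would leave the term
    \<open>a = 0\<close>.\<close>
  have "{0..N - 1} = {..<N}" using assms by auto
  then have "alt_power_sum k (N - 1) f (c ^ w) * of_nat w ^ k / fact k =
      (\<Sum>a<N. (- 1) ^ a * f (int a) * (c ^ w) ^ a * of_nat a ^ k * of_nat w ^ k / fact k)"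
    by (simp add: alt_power_sum_def sum_distrib_right sum_divide_distrib)
  also have "\<dots> = (\<Sum>a<N. ((- 1) ^ a * fps_const (f (int a)) * (?u ^ w) ^ a) $ k)"
  proof (rule sum.cong [OF refl])
    fix a
    have "(?u ^ w) ^ a = fps_const ((c ^ w) ^ a) * fps_exp (of_nat (w * a))"
      by (metis fps_const_mult_exp_power power_mult)
    then have "(- 1) ^ a * fps_const (f (int a)) * (?u ^ w) ^ a =
        fps_const ((- 1) ^ a * f (int a) * (c ^ w) ^ a) * fps_exp (of_nat (w * a))"
      by (cases "even a") (simp_all add: mult.assoc [symmetric])
    then show "(- 1) ^ a * f (int a) * (c ^ w) ^ a * of_nat a ^ k * of_nat w ^ k / fact k =
        ((- 1) ^ a * fps_const (f (int a)) * (?u ^ w) ^ a) $ k"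
      by (simp add: power_mult_distrib mult_ac)
  qed
  finally show "Abs_fps (\<lambda>k. alt_power_sum k (N - 1) f (c ^ w) * of_nat w ^ k / fact k) $ k =
      alt_twisted_sum (\<lambda>a. fps_const (f a)) N (?u ^ w) $ k"
    by (simp add: alt_twisted_sum_def fps_sum_nth)
qed

text \<open>Both products run over the same second arguments \<open>w\<close> and the same values
  \<open>v * w\<close>, the three pairwise products of \<open>w1\<close>, \<open>w2\<close>,
  \<open>w3\<close>. They thus agree after multiplication by nonzero factors, which cancel in a
  domain.\<close>

lemma alt_twisted_sum_product_swap:
  fixes f :: "int \<Rightarrow> 'a::idom"
  assumes per: "\<And>a. f (a + int d) = f a" and "odd d"
    and odd: "odd w1" "odd w2" "odd w3"
    and nz: "1 + u ^ (w1 * d) \<noteq> 0" "1 + u ^ (w2 * d) \<noteq> 0" "1 + u ^ (w3 * d) \<noteq> 0"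
  defines "F \<equiv> \<lambda>v w. alt_twisted_sum f (v * d) (u ^ w)"
  shows "F w1 w3 * F w2 w1 * F w3 w2 = F w1 w2 * F w3 w1 * F w2 w3"
proof -
  define E where "E w = 1 + u ^ (w * d)" for w
  define G where "G w = alt_twisted_sum f d (u ^ w)" for w
  have *: "E w * F v w = G w * E (v * w)" if "odd v" for v w
    using alt_twisted_sum_periodic [of f d v "u ^ w", OF per \<open>odd d\<close> that]
    by (simp add: E_def F_def G_def power_mult [symmetric] mult_ac)
  have "(E w3 * E w1 * E w2) * (F w1 w3 * F w2 w1 * F w3 w2)
      = (E w3 * F w1 w3) * (E w1 * F w2 w1) * (E w2 * F w3 w2)"
    by (simp only: mult_ac)
  also have "\<dots> = (E w2 * F w1 w2) * (E w1 * F w3 w1) * (E w3 * F w2 w3)"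
    by (simp only: odd [THEN *]) (simp only: mult_ac)
  also have "\<dots> = (E w3 * E w1 * E w2) * (F w1 w2 * F w3 w1 * F w2 w3)"
    by (simp only: mult_ac)
  finally show ?thesis using nz by (simp add: E_def)
qed

theorem theorem8:
  fixes p d n w1 w2 w3 :: nat
    and \<xi> :: "'a::{field_char_0, complete_space}"
    and \<iota> :: "complex \<Rightarrow> 'a"
    and chi :: "int \<Rightarrow> complex"
  assumes "prime p" and "odd p"
    and "completed_algebraic_closure_of_Qp p TYPE('a)"
    and "embedding_of_Qbar \<iota>"
    and "\<exists>s>0. \<xi> ^ (p ^ s) = 1"
    and "odd d" and "d > 0"
    and "primitive_dirichlet_character d chi"
    and "odd w1" and "w1 > 0" and "odd w2" and "w2 > 0" and "odd w3" and "w3 > 0"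
  shows
    "(\<Sum>(k, l, m) \<in> {(k, l, m). k + l + m = n}.
        trinomial n k l m
        * alt_power_sum k (w1 * d - 1) (\<iota> \<circ> chi) (\<xi> ^ w3)
        * alt_power_sum l (w2 * d - 1) (\<iota> \<circ> chi) (\<xi> ^ w1)
        * alt_power_sum m (w3 * d - 1) (\<iota> \<circ> chi) (\<xi> ^ w2)
        * of_nat w3 ^ k * of_nat w1 ^ l * of_nat w2 ^ m)
   = (\<Sum>(k, l, m) \<in> {(k, l, m). k + l + m = n}.
        trinomial n k l m
        * alt_power_sum k (w1 * d - 1) (\<iota> \<circ> chi) (\<xi> ^ w2)
        * alt_power_sum l (w3 * d - 1) (\<iota> \<circ> chi) (\<xi> ^ w1)
        * alt_power_sum m (w2 * d - 1) (\<iota> \<circ> chi) (\<xi> ^ w3)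
        * of_nat w2 ^ k * of_nat w1 ^ l * of_nat w3 ^ m)"
proof -
  obtain s where "\<xi> ^ (p ^ s) = 1" using assms(5) by blast
  moreover have "p ^ s \<noteq> 0" using \<open>prime p\<close> by (simp add: prime_gt_0_nat)
  ultimately have "\<xi> \<noteq> 0" by (metis power_0_left zero_neq_one)
  define f where "f = (\<lambda>a. fps_const ((\<iota> \<circ> chi) a))"
  define u where "u = fps_const \<xi> * fps_exp 1"
  define egf where
    "egf v w = Abs_fps (\<lambda>k. alt_power_sum k (v * d - 1) (\<iota> \<circ> chi) (\<xi> ^ w) * of_nat w ^ k / fact k)"
    for v w
  have egf: "egf v w = alt_twisted_sum f (v * d) (u ^ w)" if "v > 0" for v w
    unfolding egf_def f_def u_def using that \<open>d > 0\<close> by (intro alt_power_sum_egf) simp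
  have "f (a + int d) = f a" for a
    using assms(8)
    by (simp add: f_def primitive_dirichlet_character_def dirichlet_character_def)
  moreover have "1 + u ^ (w * d) \<noteq> 0" if "w > 0" for w
    unfolding u_def using that \<open>d > 0\<close> \<open>\<xi> \<noteq> 0\<close> by (intro one_plus_exp_power_nonzero) simp_all
  ultimately have "egf w1 w3 * egf w2 w1 * egf w3 w2 = egf w1 w2 * egf w3 w1 * egf w2 w3"
    using assms by (simp add: egf alt_twisted_sum_product_swap)
  \<comment> \<open>Both sides of the theorem are instances: \<open>v\<close> = (\<open>w1\<close>,
    \<open>w2\<close>, \<open>w3\<close>) with \<open>x\<close> = (\<open>w3\<close>,
    \<open>w1\<close>, \<open>w2\<close>), and \<open>v\<close> = (\<open>w1\<close>,
    \<open>w3\<close>, \<open>w2\<close>) with \<open>x\<close> = (\<open>w2\<close>,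
    \<open>w1\<close>, \<open>w3\<close>).\<close>
  moreover have "(\<Sum>(k, l, m) \<in> {(k, l, m). k + l + m = n}.
        trinomial n k l m
        * alt_power_sum k (v1 * d - 1) (\<iota> \<circ> chi) (\<xi> ^ x1)
        * alt_power_sum l (v2 * d - 1) (\<iota> \<circ> chi) (\<xi> ^ x2)
        * alt_power_sum m (v3 * d - 1) (\<iota> \<circ> chi) (\<xi> ^ x3)
        * of_nat x1 ^ k * of_nat x2 ^ l * of_nat x3 ^ m)
      = fact n * (egf v1 x1 * egf v2 x2 * egf v3 x3) $ n" for v1 v2 v3 x1 x2 x3
    unfolding egf_def trinomial_sum_eq_fps_nth [symmetric]
    by (rule sum.cong) (auto simp: mult_ac)
  ultimately show ?thesis by simp
qed

end
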